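(* Let $R$ be a commutative semiring and $M$ an $R$-semimodule. Then, for each of the distinguished classes $\mathrm{Dis}_M$ of subsemimodules of $M$, the subsemimodule space $(\mathrm{Dis}_M,\tau_{\mathrm{Dis}_M})$ is a $T_0$-space.
   Context: A (commutative) semiring is $(R,+,0,\cdot,1)$ with $(R,+,0)$ and $(R,\cdot,1)$ commutative monoids, $0r=0=r0$ for all $r$, and $\cdot$ distributing over $+$. An $R$-semimodule $M$ is an additive commutative monoid with a scalar multiplication $R\times M\to M$ satisfying $(r+r')m=rm+r'm$, $r(m+m')=rm+rm'$, $(rr')m=r(r'm)$, $1m=m$, $r0=0=0m$. A subsemimodule of $M$ is a nonempty subset closed under addition and scalar multiplication; $\mathrm{Sub}_M$ is the set of all of them. Write $(N:M)=\{r\in R\mid rM\subseteq N\}$. Distinguished classes. A subsemimodule $N$ of $M$ is: subtractive if $x+y\in N$ and $x\in N$ imply $y\in N$; strong if $x+y\in N$ implies $x,y\in N$; proper if $N\ne M$; maximal if $N$ is proper and no other proper subsemimodule contains $N$; prime if $N$ is proper and $rm\in N$ ($r\in R$, $m\in M$) implies $m\in N$ or $r\in (N:M)$; primary if $N$ is proper and $rm\in N$ implies $m\in N$ or $r^n\in (N:M)$ for some $n\in\mathbb N$; weakly prime if $N$ is proper and $0\ne rm\in N$ implies $m\in N$ or $rM\subseteq N$; primal if $N$ is proper and $R\setminus \mathrm{Prm}(N)$ is an ideal of $R$, where $\mathrm{Prm}(N)$ is the set of $r\in R$ such that, for all $m\in M$, $rm\in N$ implies $m\in N$; semiprime if $N$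 is an intersection of prime subsemimodules of $M$; extraordinary if $N$ is prime and for all semiprime subsemimodules $L,K$, $L\cap K\subseteq N$ implies $L\subseteq N$ or $K\subseteq N$; strongly irreducible if for all subsemimodules $L,K$, $L\cap K\subseteq N$ implies $L\subseteq N$ or $K\subseteq N$; irreducible (completely irreducible) if $N$ is not the intersection of two (of any set of) subsemimodules of $M$ in which $N$ is properly contained; cyclic (finitely generated) if $N$ is generated by one element (by a finite set of elements); minimal if $N\neq 0$ and $N$ contains no other nonzero subsemimodule; minimal prime if $N$ is both minimal and prime. $\mathrm{Dis}_M$ denotes the set of all subsemimodules of $M$ of any one of these types, with the convention $M\notin \mathrm{Dis}_M$. For $N\in\mathrm{Sub}_M$ put $\mathcal V(N)=\{L\in\mathrm{Dis}_M\mid N\subseteq L\}$. The topology $\tau_{\mathrm{Dis}_M}$ is the one having $\{\mathcal V(N)\}_{N\in \mathrm{Sub}_M}$ as a closed subbasis (closed sets are arbitrary intersections of finite unions of sets $\mathcal V(N)$); $\mathrm{Dis}_M$ with this topology is called a subsemimodule space. *)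

theory Defs
  imports "HOL-Algebra.Module" "HOL-Analysis.Abstract_Topological_Spaces"
begin

text \<open>The trivial semiring (one = zero) is allowed, which is why the type class of
  commutative semirings, with its axiom that zero and one differ, is not used.\<close>

locale commutative_semiring = Ring.semiring R + comm_monoid R for R (structure)

locale semimodule = R?: commutative_semiring R + M?: abelian_monoid M
  for R :: "('r, 'a) ring_scheme" (structure) and M :: "('r, 'm, 'b) module_scheme" (structure) +
  assumes smult_closed [simp, intro]:
      "\<lbrakk>r \<in> carrier R; m \<in> carrier M\<rbrakk> \<Longrightarrow> r \<odot>\<^bsub>M\<^esub> m \<in> carrier M"
    and smult_l_distr:
      "\<lbrakk>r \<in> carrier R; s \<in> carrier R; m \<in> carrier M\<rbrakk> \<Longrightarrow>
        (r \<oplus>\<^bsub>R\<^esub> s) \<odot>\<^bsub>M\<^esub> m = r \<odot>\<^bsub>M\<^esub> m \<oplus>\<^bsub>M\<^esub> s \<odot>\<^bsub>M\<^esub> m"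
    and smult_r_distr:
      "\<lbrakk>r \<in> carrier R; m \<in> carrier M; n \<in> carrier M\<rbrakk> \<Longrightarrow>
        r \<odot>\<^bsub>M\<^esub> (m \<oplus>\<^bsub>M\<^esub> n) = r \<odot>\<^bsub>M\<^esub> m \<oplus>\<^bsub>M\<^esub> r \<odot>\<^bsub>M\<^esub> n"
    and smult_assoc:
      "\<lbrakk>r \<in> carrier R; s \<in> carrier R; m \<in> carrier M\<rbrakk> \<Longrightarrow>
        (r \<otimes>\<^bsub>R\<^esub> s) \<odot>\<^bsub>M\<^esub> m = r \<odot>\<^bsub>M\<^esub> (s \<odot>\<^bsub>M\<^esub> m)"
    and smult_one [simp]: "m \<in> carrier M \<Longrightarrow> \<one>\<^bsub>R\<^esub> \<odot>\<^bsub>M\<^esub> m = m"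
    and smult_r_null [simp]: "r \<in> carrier R \<Longrightarrow> r \<odot>\<^bsub>M\<^esub> \<zero>\<^bsub>M\<^esub> = \<zero>\<^bsub>M\<^esub>"
    and smult_l_null [simp]: "m \<in> carrier M \<Longrightarrow> \<zero>\<^bsub>R\<^esub> \<odot>\<^bsub>M\<^esub> m = \<zero>\<^bsub>M\<^esub>"

definition subsemimodules ::
  "('r, 'a) ring_scheme \<Rightarrow> ('r, 'm, 'b) module_scheme \<Rightarrow> 'm set set" where
  "subsemimodules R M = {N. N \<subseteq> carrier M \<and> N \<noteq> {} \<and>
     (\<forall>x\<in>N. \<forall>y\<in>N. x \<oplus>\<^bsub>M\<^esub> y \<in> N) \<and> (\<forall>r\<in>carrier R. \<forall>x\<in>N. r \<odot>\<^bsub>M\<^esub> x \<in> N)}"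

text \<open>The set (N : M).\<close>

definition colon :: "('r, 'a) ring_scheme \<Rightarrow> ('r, 'm, 'b) module_scheme \<Rightarrow> 'm set \<Rightarrow> 'r set" where
  "colon R M N = {r \<in> carrier R. \<forall>m\<in>carrier M. r \<odot>\<^bsub>M\<^esub> m \<in> N}"

text \<open>The library's ideals are additive subgroups of a ring, hence not available over a semiring.\<close>

definition semiring_ideal :: "('r, 'a) ring_scheme \<Rightarrow> 'r set \<Rightarrow> bool" where
  "semiring_ideal R I \<longleftrightarrow> I \<subseteq> carrier R \<and> I \<noteq> {} \<and>
     (\<forall>x\<in>I. \<forall>y\<in>I. x \<oplus>\<^bsub>R\<^esub> y \<in> I) \<and> (\<forall>r\<in>carrier R. \<forall>x\<in>I. r \<otimes>\<^bsub>R\<^esub> x \<in> I)"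


subsection \<open>Distinguished types of subsemimodules\<close>

definition subtractive_sub ::
  "('r, 'a) ring_scheme \<Rightarrow> ('r, 'm, 'b) module_scheme \<Rightarrow> 'm set \<Rightarrow> bool" where
  "subtractive_sub R M N \<longleftrightarrow> N \<in> subsemimodules R M \<and>
     (\<forall>x\<in>carrier M. \<forall>y\<in>carrier M. x \<oplus>\<^bsub>M\<^esub> y \<in> N \<and> x \<in> N \<longrightarrow> y \<in> N)"

definition strong_sub ::
  "('r, 'a) ring_scheme \<Rightarrow> ('r, 'm, 'b) module_scheme \<Rightarrow> 'm set \<Rightarrow> bool" where
  "strong_sub R M N \<longleftrightarrow> N \<in> subsemimodules R M \<and>
     (\<forall>x\<in>carrier M. \<forall>y\<in>carrier M. x \<oplus>\<^bsub>M\<^esub> y \<in> N \<longrightarrow> x \<in> N \<and> y \<in> N)"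

definition proper_sub ::
  "('r, 'a) ring_scheme \<Rightarrow> ('r, 'm, 'b) module_scheme \<Rightarrow> 'm set \<Rightarrow> bool" where
  "proper_sub R M N \<longleftrightarrow> N \<in> subsemimodules R M \<and> N \<noteq> carrier M"

definition maximal_sub ::
  "('r, 'a) ring_scheme \<Rightarrow> ('r, 'm, 'b) module_scheme \<Rightarrow> 'm set \<Rightarrow> bool" where
  "maximal_sub R M N \<longleftrightarrow> proper_sub R M N \<and>
     (\<forall>L. proper_sub R M L \<and> N \<subseteq> L \<longrightarrow> L = N)"

definition prime_sub ::
  "('r, 'a) ring_scheme \<Rightarrow> ('r, 'm, 'b) module_scheme \<Rightarrow> 'm set \<Rightarrow> bool" where
  "prime_sub R M N \<longleftrightarrow> proper_sub R M N \<and>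
     (\<forall>r\<in>carrier R. \<forall>m\<in>carrier M. r \<odot>\<^bsub>M\<^esub> m \<in> N \<longrightarrow> m \<in> N \<or> r \<in> colon R M N)"

definition primary_sub ::
  "('r, 'a) ring_scheme \<Rightarrow> ('r, 'm, 'b) module_scheme \<Rightarrow> 'm set \<Rightarrow> bool" where
  "primary_sub R M N \<longleftrightarrow> proper_sub R M N \<and>
     (\<forall>r\<in>carrier R. \<forall>m\<in>carrier M.
        r \<odot>\<^bsub>M\<^esub> m \<in> N \<longrightarrow> m \<in> N \<or> (\<exists>n::nat. r [^]\<^bsub>R\<^esub> n \<in> colon R M N))"

definition weakly_prime_sub ::
  "('r, 'a) ring_scheme \<Rightarrow> ('r, 'm, 'b) module_scheme \<Rightarrow> 'm set \<Rightarrow> bool" where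
  "weakly_prime_sub R M N \<longleftrightarrow> proper_sub R M N \<and>
     (\<forall>r\<in>carrier R. \<forall>m\<in>carrier M.
        r \<odot>\<^bsub>M\<^esub> m \<noteq> \<zero>\<^bsub>M\<^esub> \<and> r \<odot>\<^bsub>M\<^esub> m \<in> N \<longrightarrow> m \<in> N \<or> (\<forall>x\<in>carrier M. r \<odot>\<^bsub>M\<^esub> x \<in> N))"

definition Prm :: "('r, 'a) ring_scheme \<Rightarrow> ('r, 'm, 'b) module_scheme \<Rightarrow> 'm set \<Rightarrow> 'r set" where
  "Prm R M N = {r \<in> carrier R. \<forall>m\<in>carrier M. r \<odot>\<^bsub>M\<^esub> m \<in> N \<longrightarrow> m \<in> N}"

definition primal_sub ::
  "('r, 'a) ring_scheme \<Rightarrow> ('r, 'm, 'b) module_scheme \<Rightarrow> 'm set \<Rightarrow> bool" where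
  "primal_sub R M N \<longleftrightarrow> proper_sub R M N \<and> semiring_ideal R (carrier R - Prm R M N)"

text \<open>Intersections of families of subsemimodules are taken inside M, so that the empty family
  has intersection M.\<close>

definition semiprime_sub ::
  "('r, 'a) ring_scheme \<Rightarrow> ('r, 'm, 'b) module_scheme \<Rightarrow> 'm set \<Rightarrow> bool" where
  "semiprime_sub R M N \<longleftrightarrow> (\<exists>\<P>. (\<forall>P\<in>\<P>. prime_sub R M P) \<and> N = carrier M \<inter> \<Inter>\<P>)"

definition extraordinary_sub ::
  "('r, 'a) ring_scheme \<Rightarrow> ('r, 'm, 'b) module_scheme \<Rightarrow> 'm set \<Rightarrow> bool" where
  "extraordinary_sub R M N \<longleftrightarrow> prime_sub R M N \<and>
     (\<forall>L K. semiprime_sub R M L \<and> semiprime_sub R M K \<and> L \<inter> K \<subseteq> N \<longrightarrow> L \<subseteq> N \<or> K \<subseteq> N)"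

definition strongly_irreducible_sub ::
  "('r, 'a) ring_scheme \<Rightarrow> ('r, 'm, 'b) module_scheme \<Rightarrow> 'm set \<Rightarrow> bool" where
  "strongly_irreducible_sub R M N \<longleftrightarrow> N \<in> subsemimodules R M \<and>
     (\<forall>L\<in>subsemimodules R M. \<forall>K\<in>subsemimodules R M. L \<inter> K \<subseteq> N \<longrightarrow> L \<subseteq> N \<or> K \<subseteq> N)"

definition irreducible_sub ::
  "('r, 'a) ring_scheme \<Rightarrow> ('r, 'm, 'b) module_scheme \<Rightarrow> 'm set \<Rightarrow> bool" where
  "irreducible_sub R M N \<longleftrightarrow> N \<in> subsemimodules R M \<and>
     \<not> (\<exists>L\<in>subsemimodules R M. \<exists>K\<in>subsemimodules R M. N \<subset> L \<and> N \<subset> K \<and> N = L \<inter> K)"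

definition completely_irreducible_sub ::
  "('r, 'a) ring_scheme \<Rightarrow> ('r, 'm, 'b) module_scheme \<Rightarrow> 'm set \<Rightarrow> bool" where
  "completely_irreducible_sub R M N \<longleftrightarrow> N \<in> subsemimodules R M \<and>
     \<not> (\<exists>\<L> \<subseteq> subsemimodules R M. (\<forall>L\<in>\<L>. N \<subset> L) \<and> N = carrier M \<inter> \<Inter>\<L>)"

definition generated_sub ::
  "('r, 'a) ring_scheme \<Rightarrow> ('r, 'm, 'b) module_scheme \<Rightarrow> 'm set \<Rightarrow> 'm set" where
  "generated_sub R M S = (\<lambda>L. L \<in> subsemimodules R M) hull S"

definition cyclic_sub ::
  "('r, 'a) ring_scheme \<Rightarrow> ('r, 'm, 'b) module_scheme \<Rightarrow> 'm set \<Rightarrow> bool" where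
  "cyclic_sub R M N \<longleftrightarrow> N \<in> subsemimodules R M \<and>
     (\<exists>m\<in>carrier M. N = generated_sub R M {m})"

definition finitely_generated_sub ::
  "('r, 'a) ring_scheme \<Rightarrow> ('r, 'm, 'b) module_scheme \<Rightarrow> 'm set \<Rightarrow> bool" where
  "finitely_generated_sub R M N \<longleftrightarrow> N \<in> subsemimodules R M \<and>
     (\<exists>F \<subseteq> carrier M. finite F \<and> N = generated_sub R M F)"

definition minimal_sub ::
  "('r, 'a) ring_scheme \<Rightarrow> ('r, 'm, 'b) module_scheme \<Rightarrow> 'm set \<Rightarrow> bool" where
  "minimal_sub R M N \<longleftrightarrow> N \<in> subsemimodules R M \<and> N \<noteq> {\<zero>\<^bsub>M\<^esub>} \<and>
     (\<forall>L\<in>subsemimodules R M. L \<noteq> {\<zero>\<^bsub>M\<^esub>} \<and> L \<subseteq> N \<longrightarrow> L = N)"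

definition minimal_prime_sub ::
  "('r, 'a) ring_scheme \<Rightarrow> ('r, 'm, 'b) module_scheme \<Rightarrow> 'm set \<Rightarrow> bool" where
  "minimal_prime_sub R M N \<longleftrightarrow> minimal_sub R M N \<and> prime_sub R M N"

definition distinguished_types ::
  "('r, 'a) ring_scheme \<Rightarrow> ('r, 'm, 'b) module_scheme \<Rightarrow> ('m set \<Rightarrow> bool) set" where
  "distinguished_types R M =
    {subtractive_sub R M, strong_sub R M, proper_sub R M, maximal_sub R M, prime_sub R M,
     primary_sub R M, weakly_prime_sub R M, primal_sub R M, semiprime_sub R M,
     extraordinary_sub R M, strongly_irreducible_sub R M, irreducible_sub R M,
     completely_irreducible_sub R M, cyclic_sub R M, finitely_generated_sub R M,
     minimal_sub R M, minimal_prime_sub R M}"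

text \<open>The class Dis of all subsemimodules of one fixed type, with the convention that M itself
  is never a member.\<close>

definition distinguished_classes ::
  "('r, 'a) ring_scheme \<Rightarrow> ('r, 'm, 'b) module_scheme \<Rightarrow> 'm set set set" where
  "distinguished_classes R M =
    {{N \<in> subsemimodules R M. P N \<and> N \<noteq> carrier M} | P. P \<in> distinguished_types R M}"


subsection \<open>Subsemimodule spaces\<close>

definition dis_V :: "'m set set \<Rightarrow> 'm set \<Rightarrow> 'm set set" where
  "dis_V Dis N = {L \<in> Dis. N \<subseteq> L}"

text \<open>The topology on Dis whose open subbasis consists of the complements of the sets
  dis_V Dis N; the closed sets are characterized below.\<close>

definition subsemimodule_space ::
  "('r, 'a) ring_scheme \<Rightarrow> ('r, 'm, 'b) module_scheme \<Rightarrow> 'm set set \<Rightarrow> 'm set topology" where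
  "subsemimodule_space R M Dis =
     topology (arbitrary union_of
       (finite intersection_of (\<lambda>U. \<exists>N\<in>subsemimodules R M. U = Dis - dis_V Dis N) relative_to Dis))"

lemma topspace_subsemimodule_space [simp]: "topspace (subsemimodule_space R M Dis) = Dis"
  by (simp add: subsemimodule_space_def)

lemma closedin_subsemimodule_space:
  "closedin (subsemimodule_space R M Dis) C \<longleftrightarrow>
     (arbitrary intersection_of (finite union_of (\<lambda>A. A \<in> dis_V Dis ` subsemimodules R M))
       relative_to Dis) C"
proof -
  define P where "P = (\<lambda>U. \<exists>N\<in>subsemimodules R M. U = Dis - dis_V Dis N)"
  define Q where "Q = (\<lambda>A. A \<in> dis_V Dis ` subsemimodules R M)"
  have compl: "(arbitrary union_of (finite intersection_of P)) W \<longleftrightarrow>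
      (arbitrary intersection_of (finite union_of (\<lambda>A. P (- A)))) (- W)" for W
    by (simp add: arbitrary_union_of_complement finite_intersection_of_complement)
  have rel: "(\<lambda>A. P (- A)) relative_to Dis = Q relative_to Dis"
  proof (rule ext, rule iffI)
    fix A assume "((\<lambda>A. P (- A)) relative_to Dis) A"
    then obtain B N where B: "N \<in> subsemimodules R M" "- B = Dis - dis_V Dis N" "A = Dis \<inter> B"
      by (auto simp: relative_to_def P_def)
    then have "A = Dis \<inter> dis_V Dis N" by (auto simp: dis_V_def)
    with B show "(Q relative_to Dis) A" by (auto simp: relative_to_def Q_def)
  next
    fix A assume "(Q relative_to Dis) A"
    then obtain N where N: "N \<in> subsemimodules R M" "A = Dis \<inter> dis_V Dis N"
      by (auto simp: relative_to_def Q_def)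
    then have "P (- (- Dis \<union> dis_V Dis N))" "Dis \<inter> (- Dis \<union> dis_V Dis N) = A"
      by (auto simp: P_def)
    then show "((\<lambda>A. P (- A)) relative_to Dis) A" unfolding relative_to_def by blast
  qed
  have "closedin (subsemimodule_space R M Dis) C \<longleftrightarrow>
      C \<subseteq> Dis \<and> ((arbitrary union_of (finite intersection_of P)) relative_to Dis) (Dis - C)"
    by (simp add: closedin_def arbitrary_union_of_relative_to)
      (simp add: subsemimodule_space_def openin_subbase P_def)
  also have "\<dots> \<longleftrightarrow>
      ((arbitrary intersection_of (finite union_of (\<lambda>A. P (- A)))) relative_to Dis) C"
    (is "?L \<longleftrightarrow> ?R")
  proof
    assume ?L
    then obtain W where "C \<subseteq> Dis" "(arbitrary union_of (finite intersection_of P)) W"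
        "Dis \<inter> W = Dis - C"
      by (auto simp: relative_to_def)
    then have "(arbitrary intersection_of (finite union_of (\<lambda>A. P (- A)))) (- W)" "Dis \<inter> - W = C"
      using compl by blast+
    then show ?R unfolding relative_to_def by blast
  next
    assume ?R
    then obtain W where W: "(arbitrary intersection_of (finite union_of (\<lambda>A. P (- A)))) W"
        "Dis \<inter> W = C"
      by (auto simp: relative_to_def)
    then have "(arbitrary union_of (finite intersection_of P)) (- W)" "Dis \<inter> - W = Dis - C" "C \<subseteq> Dis"
      using compl[of "- W"] by auto
    then show ?L unfolding relative_to_def by blast
  qed
  also have "\<dots> \<longleftrightarrow> ((arbitrary intersection_of (finite union_of Q)) relative_to Dis) C"
    using arbitrary_intersection_of_relative_to [of "finite union_of (\<lambda>A. P (- A))" Dis]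
      arbitrary_intersection_of_relative_to [of "finite union_of Q" Dis]
      finite_union_of_relative_to [of "\<lambda>A. P (- A)" Dis] finite_union_of_relative_to [of Q Dis]
    by (simp add: rel)
  finally show ?thesis by (simp add: Q_def)
qed

end

theory Submission
  imports Defs
begin

text \<open>Of two distinct subsemimodules \<open>L\<close> and \<open>K\<close>, one is not contained in the other, say \<open>L\<close>
  is not contained in \<open>K\<close>. Every member of a distinguished class is itself a subsemimodule, so
  \<open>L\<close> is an index of the subbasis, and the subbasic closed set of all members above \<open>L\<close> contains
  \<open>L\<close> but misses \<open>K\<close>. This separates the points in every family of subsemimodules, hence in all
  the distinguished classes at once.\<close>

lemma openin_complement_dis_V:
  assumes "N \<in> subsemimodules R M"
  shows "openin (subsemimodule_space R M Dis) (Dis - dis_V Dis N)"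
proof -
  let ?P = "\<lambda>U. \<exists>N\<in>subsemimodules R M. U = Dis - dis_V Dis N"
  have "(finite intersection_of ?P) (Dis - dis_V Dis N)"
    using assms by (blast intro: finite_intersection_of_inc)
  then have "(finite intersection_of ?P relative_to Dis) (Dis \<inter> (Dis - dis_V Dis N))"
    by (rule relative_to_inc)
  moreover have "Dis \<inter> (Dis - dis_V Dis N) = Dis - dis_V Dis N"
    by blast
  ultimately show ?thesis
    by (simp add: subsemimodule_space_def openin_subbase arbitrary_union_of_inc)
qed

lemma t0_space_subsemimodule_space:
  assumes "Dis \<subseteq> subsemimodules R M"
  shows "t0_space (subsemimodule_space R M Dis)"
  unfolding t0_space_def
proof (intro ballI impI)
  fix L K
  assume "L \<in> topspace (subsemimodule_space R M Dis)" "K \<in> topspace (subsemimodule_space R M Dis)"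
  then have mem: "L \<in> Dis" "K \<in> Dis"
    by simp_all
  then have "openin (subsemimodule_space R M Dis) (Dis - dis_V Dis L)"
    and "openin (subsemimodule_space R M Dis) (Dis - dis_V Dis K)"
    using assms by (auto intro: openin_complement_dis_V)
  moreover assume "L \<noteq> K"
  then have "\<not> L \<subseteq> K \<or> \<not> K \<subseteq> L"
    by blast
  then have "(L \<notin> Dis - dis_V Dis L \<and> K \<in> Dis - dis_V Dis L) \<or>
      (L \<in> Dis - dis_V Dis K \<and> K \<notin> Dis - dis_V Dis K)"
    using mem by (simp add: dis_V_def)
  ultimately show "\<exists>U. openin (subsemimodule_space R M Dis) U \<and> (L \<notin> U \<longleftrightarrow> K \<in> U)"
    by blast
qed

theorem proposition3p4:
  fixes R :: "('r, 'a) ring_scheme" and M :: "('r, 'm, 'b) module_scheme"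
  assumes "semimodule R M"
  shows "\<forall>Dis \<in> distinguished_classes R M. t0_space (subsemimodule_space R M Dis)"
proof
  fix Dis assume "Dis \<in> distinguished_classes R M"
  then have "Dis \<subseteq> subsemimodules R M"
    by (auto simp: distinguished_classes_def)
  then show "t0_space (subsemimodule_space R M Dis)"
    by (rule t0_space_subsemimodule_space)
qed

end
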